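(* Let $M$ be a matroid on a finite ground set $E$ with rank function $r_M$, let $q$ be a non-zero (complex) number, and let $\bm v=(v_e)_{e\in E}$ and $\bm u=(u_e)_{e\in E}$ be arbitrary sequences of (complex) numbers indexed by $E$. Then $$\widetilde Z(M;q,\bm v)=\sum_{F\subseteq E}q^{-r_M(F)}\Big(\prod_{e\in F}(v_e-u_e)\Big)\,\widetilde Z\big(M/F;q,(u_e)_{e\in E-F}\big).$$
   Context: A matroid $M$ on a finite ground set $E$ is determined by its rank function $r_M:2^E\to\mathbb Z_{\ge 0}$. For a non-zero number $q$ and a sequence $\bm v=(v_e)_{e\in E}$ of numbers, the normalized Potts model partition function of $M$ is $$\widetilde Z(M;q,\bm v)=\sum_{A\subseteq E}q^{-r_M(A)}\prod_{e\in A}v_e.$$ For $F\subseteq E$, the contraction $M/F$ is the matroid on $E-F$ with rank function $r_{M/F}(A)=r_M(A\cup F)-r_M(F)$ for all $A\subseteq E-F$. Empty products equal $1$. *)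

theory Defs
  imports Complex_Main
begin

record 'a matroid_data =
  ground :: "'a set"
  rk :: "'a set \<Rightarrow> nat"

text \<open>Matroids via the rank axioms. Only the values of \<open>rk M\<close> on subsets of the ground set
  are constrained, and only these values are ever used.\<close>

definition matroid :: "'a matroid_data \<Rightarrow> bool" where
  "matroid M \<longleftrightarrow>
     finite (ground M) \<and>
     (\<forall>A. A \<subseteq> ground M \<longrightarrow> rk M A \<le> card A) \<and>
     (\<forall>A B. A \<subseteq> B \<longrightarrow> B \<subseteq> ground M \<longrightarrow> rk M A \<le> rk M B) \<and>
     (\<forall>A B. A \<subseteq> ground M \<longrightarrow> B \<subseteq> ground M \<longrightarrow>
        rk M (A \<union> B) + rk M (A \<inter> B) \<le> rk M A + rk M B)"

text \<open>The subtraction of natural numbers does not truncate for subsets of the ground set of a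
  matroid, by monotonicity of the rank.\<close>

definition contract :: "'a matroid_data \<Rightarrow> 'a set \<Rightarrow> 'a matroid_data" where
  "contract M F = \<lparr>ground = ground M - F, rk = (\<lambda>A. rk M (A \<union> F) - rk M F)\<rparr>"

text \<open>The weights form a total function, of which only the values on the ground set matter; so
  the restriction of a weight sequence to a smaller ground set is given by the same function.\<close>

definition potts_Z :: "'a matroid_data \<Rightarrow> complex \<Rightarrow> ('a \<Rightarrow> complex) \<Rightarrow> complex" where
  "potts_Z M q v = (\<Sum>A\<in>Pow (ground M). q powi (- int (rk M A)) * (\<Prod>e\<in>A. v e))"

lemma potts_Z_cong:
  assumes "\<And>e. e \<in> ground M \<Longrightarrow> v e = w e"
  shows "potts_Z M q v = potts_Z M q w"
  unfolding potts_Z_def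
proof (rule sum.cong)
  fix A assume "A \<in> Pow (ground M)"
  then have "(\<Prod>e\<in>A. v e) = (\<Prod>e\<in>A. w e)"
    using assms by (intro prod.cong) auto
  then show "q powi (- int (rk M A)) * (\<Prod>e\<in>A. v e) = q powi (- int (rk M A)) * (\<Prod>e\<in>A. w e)"
    by simp
qed simp

lemma matroid_contract:
  assumes M: "matroid M" and F: "F \<subseteq> ground M"
  shows "matroid (contract M F)"
proof -
  let ?E = "ground M" and ?r = "rk M"
  have fin: "finite ?E" and le: "\<And>A. A \<subseteq> ?E \<Longrightarrow> ?r A \<le> card A"
    and mono: "\<And>A B. A \<subseteq> B \<Longrightarrow> B \<subseteq> ?E \<Longrightarrow> ?r A \<le> ?r B"
    and sub: "\<And>A B. A \<subseteq> ?E \<Longrightarrow> B \<subseteq> ?E \<Longrightarrow> ?r (A \<union> B) + ?r (A \<inter> B) \<le> ?r A + ?r B"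
    using M unfolding matroid_def by auto
  have "?r (A \<union> F) - ?r F \<le> card A" if "A \<subseteq> ?E - F" for A
  proof -
    have "A \<subseteq> ?E" using that by blast
    then show ?thesis using sub[of A F] le[of A] F by linarith
  qed
  moreover have "?r (A \<union> F) - ?r F \<le> ?r (B \<union> F) - ?r F" if "A \<subseteq> B" "B \<subseteq> ?E - F" for A B
  proof -
    have "A \<union> F \<subseteq> B \<union> F" "B \<union> F \<subseteq> ?E" using that F by auto
    then show ?thesis using mono diff_le_mono by blast
  qed
  moreover have "(?r (A \<union> B \<union> F) - ?r F) + (?r (A \<inter> B \<union> F) - ?r F)
      \<le> (?r (A \<union> F) - ?r F) + (?r (B \<union> F) - ?r F)"
    if "A \<subseteq> ?E - F" "B \<subseteq> ?E - F" for A B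
  proof -
    have AB: "A \<union> F \<subseteq> ?E" "B \<union> F \<subseteq> ?E" using that F by auto
    have eqs: "(A \<union> F) \<union> (B \<union> F) = A \<union> B \<union> F" "(A \<union> F) \<inter> (B \<union> F) = A \<inter> B \<union> F" by auto
    have "?r (A \<union> B \<union> F) + ?r (A \<inter> B \<union> F) \<le> ?r (A \<union> F) + ?r (B \<union> F)"
      using sub[OF AB] unfolding eqs .
    moreover have "?r F \<le> ?r (A \<union> F)" "?r F \<le> ?r (B \<union> F)"
      using AB by (auto intro: mono)
    moreover have "A \<union> B \<union> F \<subseteq> ?E" "A \<inter> B \<union> F \<subseteq> ?E" using AB by auto
    then have "?r F \<le> ?r (A \<union> B \<union> F)" "?r F \<le> ?r (A \<inter> B \<union> F)"
      by (auto intro: mono)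
    ultimately show ?thesis by linarith
  qed
  ultimately show ?thesis
    using fin unfolding matroid_def contract_def by simp
qed

end

theory Submission
  imports Defs
begin

text \<open>Expand \<open>(\<Prod>e\<in>B. v e) = (\<Prod>e\<in>B. (v e - u e) + u e)\<close> over the subsets
  \<open>F\<close> of \<open>B\<close> and exchange the two sums: for fixed \<open>F\<close>, the sets \<open>B\<close> with
  \<open>F \<subseteq> B \<subseteq> E\<close> are the sets \<open>A \<union> F\<close> with \<open>A \<subseteq> E - F\<close>, and the rank of \<open>A \<union> F\<close> is the
  rank of \<open>F\<close> plus the rank of \<open>A\<close> in the contraction.\<close>

lemma powi_rk_contract:
  fixes q :: complex
  assumes "matroid M" and "q \<noteq> 0" and "F \<subseteq> B" and "B \<subseteq> ground M"
  shows "q powi (- int (rk M F)) * q powi (- int (rk (contract M F) (B - F))) =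
    q powi (- int (rk M B))"
proof -
  \<comment> \<open>Monotonicity of the rank keeps the natural-number subtraction in
    \<open>contract\<close> from truncating, so the exponents add exactly.\<close>
  have "rk M F \<le> rk M B" and "B - F \<union> F = B"
    using assms by (auto simp: matroid_def)
  then have "- int (rk M B) = - int (rk M F) + - int (rk (contract M F) (B - F))"
    by (simp add: contract_def)
  then show ?thesis
    using power_int_add[of q] \<open>q \<noteq> 0\<close> by metis
qed

theorem theorem3p4:
  fixes M :: "'a matroid_data" and q :: complex and v u :: "'a \<Rightarrow> complex"
  assumes "matroid M" and "q \<noteq> 0"
  shows "potts_Z M q v =
    (\<Sum>F\<in>Pow (ground M).
       q powi (- int (rk M F)) * (\<Prod>e\<in>F. v e - u e) * potts_Z (contract M F) q u)"
proof -
  let ?E = "ground M" and ?d = "\<lambda>e. v e - u e"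
  \<comment> \<open>The share of \<open>F \<subseteq> B\<close> in the summand of \<open>B\<close>:
    the factors \<open>v e - u e\<close> are chosen on \<open>F\<close>, the factors
    \<open>u e\<close> elsewhere.\<close>
  let ?t = "\<lambda>B F. q powi (- int (rk M B)) * (prod ?d F * prod u (B - F))"
  have fin: "finite ?E" using assms by (simp add: matroid_def)
  have expand: "q powi (- int (rk M B)) * prod v B = (\<Sum>F\<in>Pow B. ?t B F)"
    if "B \<in> Pow ?E" for B
  proof -
    have "finite B" using that fin finite_subset by auto
    then show ?thesis
      using prod_add[of B ?d u] by (simp add: sum_distrib_left)
  qed
  have collect: "(\<Sum>B | B \<in> Pow ?E \<and> F \<subseteq> B. ?t B F) =
      q powi (- int (rk M F)) * prod ?d F * potts_Z (contract M F) q u"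
    if "F \<in> Pow ?E" for F
  proof -
    have "(\<Sum>B | B \<in> Pow ?E \<and> F \<subseteq> B. ?t B F) =
        (\<Sum>A\<in>Pow (?E - F). q powi (- int (rk M F)) * prod ?d F *
           (q powi (- int (rk (contract M F) A)) * prod u A))"
    proof (rule sum.reindex_bij_witness[where i = "\<lambda>A. A \<union> F" and j = "\<lambda>B. B - F"])
      fix B assume "B \<in> {B. B \<in> Pow ?E \<and> F \<subseteq> B}"
      then have "F \<subseteq> B" and "B \<subseteq> ?E" by auto
      from powi_rk_contract[OF assms this, symmetric]
      show "q powi (- int (rk M F)) * prod ?d F *
          (q powi (- int (rk (contract M F) (B - F))) * prod u (B - F)) = ?t B F"
        by (simp only: mult_ac)
    qed (use that in auto)
    then show ?thesis
      by (simp add: potts_Z_def contract_def sum_distrib_left)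
  qed
  have "potts_Z M q v = (\<Sum>B\<in>Pow ?E. \<Sum>F\<in>Pow B. ?t B F)"
    unfolding potts_Z_def using expand by (rule sum.cong[OF refl])
  \<comment> \<open>The inner range becomes a condition on members of the fixed set
    \<open>Pow ?E\<close>, the form in which the two sums can be swapped.\<close>
  also have "\<dots> = (\<Sum>B\<in>Pow ?E. \<Sum>F | F \<in> Pow ?E \<and> F \<subseteq> B. ?t B F)"
    by (intro sum.cong) auto
  also have "\<dots> = (\<Sum>F\<in>Pow ?E. \<Sum>B | B \<in> Pow ?E \<and> F \<subseteq> B. ?t B F)"
    using fin by (intro sum.swap_restrict) simp_all
  also have "\<dots> = (\<Sum>F\<in>Pow ?E.
       q powi (- int (rk M F)) * prod ?d F * potts_Z (contract M F) q u)"
    using collect by (rule sum.cong[OF refl])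
  finally show ?thesis .
qed

end
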